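(* Let $f\in C^2(\mathbb{R}^N,\mathbb{R})$ and consider the Hessian driven damping second order system $$\ddot{x}(t)+\frac{\alpha}{t}\dot{x}(t)+\beta\nabla^2 f(x(t))\dot{x}(t) = -\frac{\beta}{t}\nabla f(x(t)) - \nabla f\big(\mathcal{A}(t,x(t),\dot{x}(t))\big),$$ where $$\mathcal{A}(t,x,v) = x+\gamma\left(1-\frac{\alpha\gamma}{t}\right)v - \beta\gamma^2\nabla^2 f(x)v - \frac{\beta\gamma^2}{t}\nabla f(x).$$ Then the Lie-Trotter splitting discretization of this system, with a forward Euler method on the first subproblem $(P_1)$ and the symplectic Euler integrator on the second subproblem $(P_2)$ (as described in the context, with $\gamma=h$, $t_n=nh$ and with the Hessian term approximated by a difference of two consecutive gradients), leads to the IGAHD-type algorithm: for every $n\ge1$, $$y_n = x_n+\alpha_n(x_n-x_{n-1}) - \beta h\left[\nabla f(x_n)-\nabla f(x_{n-1})\right] - \frac{\beta h}{n}\nabla f(x_n), \qquad x_{n+1}=y_n-h^2\nabla f(y_n),$$ with $\alpha_n = 1-\frac{\alpha}{n}$.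
   Context: Here $\alpha,\beta$ are real parameters, $h>0$ is the stepsize, $\gamma=h$, $t_n=nh$, $\alpha_n = 1-\frac{\alpha h}{t_n}=1-\frac{\alpha}{n}$. With $v=\dot{x}$, the system is split into $(P_1)$: $\dot{x}=0$, $\ \dot{v}=-\frac{\alpha}{t}v-\beta\nabla^2 f(x)v-\frac{\beta}{t}\nabla f(x)-\nabla f(\mathcal{A}(t,x,v))+\nabla f(x)$ (non-potential forces); $(P_2)$: $\dot{x}=v$, $\ \dot{v}=-\nabla f(x)$ (potential forces). Given $x_0,x_1\in\mathbb{R}^N$, and $v_1=\frac{x_1-x_0}{h}$, one step of the scheme, for $n\ge1$, is: first an explicit forward Euler step of size $h$ at time $t_n$ for $(P_1)$ from $(x_n,v_n)$, giving $(x_{n+1/2},v_{n+1/2})$, i.e. $$x_{n+1/2}=x_n,\qquad v_{n+1/2}=v_n+h\left(-\tfrac{\alpha}{t_n}v_n-\beta\nabla^2 f(x_n)v_n-\tfrac{\beta}{t_n}\nabla f(x_n)-\nabla f(\mathcal{A}(t_n,x_n,v_n))+\nabla f(x_n)\right),$$ in which every occurrence of $\nabla^2 f(x_n)v_n$ (including the one inside $\mathcal{A}(t_n,x_n,v_n)$) is replaced by the approximation $\frac{1}{h}\left[\nabla f(x_n)-\nabla f(x_{n-1})\right]$; then a symplectic Euler step of size $h$ for $(P_2)$: $$v_{n+1}=v_{n+1/2}-h\nabla f(x_{n+1/2}),\qquad x_{n+1}=x_{n+1/2}+h v_{n+1}.$$ The Lie-Trotter splitting solution after the step is $(x_{n+1},v_{n+1})$.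 *)

theory Defs
  imports "HOL-Analysis.Analysis"
begin

subsection \<open>Gradient, Hessian, class C2\<close>

definition grad :: "(real ^ 'n \<Rightarrow> real) \<Rightarrow> real ^ 'n \<Rightarrow> real ^ 'n" where
  "grad f x = (THE D. GDERIV f x :> D)"

definition hessian :: "(real ^ 'n \<Rightarrow> real) \<Rightarrow> real ^ 'n \<Rightarrow> real ^ 'n ^ 'n" where
  "hessian f x = jacobian (grad f) (at x)"

definition C2 :: "(real ^ 'n \<Rightarrow> real) \<Rightarrow> bool" where
  "C2 f \<longleftrightarrow> (\<forall>x. f differentiable (at x)) \<and> (\<forall>x. grad f differentiable (at x)) \<and>
     continuous_on UNIV (hessian f)"


subsection \<open>The Hessian driven damping system\<close>

text \<open>The parameter \<open>H\<close> below is the rule computing the product of the Hessian at \<open>x\<close> with \<open>v\<close>.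
  The continuous system uses the exact product \<open>hess_vec f\<close>; the discretization uses
  a difference of gradients in every place where the product occurs.\<close>

definition hess_vec :: "(real ^ 'n \<Rightarrow> real) \<Rightarrow> real ^ 'n \<Rightarrow> real ^ 'n \<Rightarrow> real ^ 'n" where
  "hess_vec f x v = hessian f x *v v"

definition extrapolation ::
  "(real ^ 'n \<Rightarrow> real ^ 'n \<Rightarrow> real ^ 'n) \<Rightarrow> (real ^ 'n \<Rightarrow> real) \<Rightarrow> real \<Rightarrow> real \<Rightarrow> real \<Rightarrow>
   real \<Rightarrow> real ^ 'n \<Rightarrow> real ^ 'n \<Rightarrow> real ^ 'n" where
  "extrapolation H f \<alpha> \<beta> \<gamma> t x v =
     x + (\<gamma> * (1 - \<alpha> * \<gamma> / t)) *\<^sub>R v - (\<beta> * \<gamma>\<^sup>2) *\<^sub>R H x v - (\<beta> * \<gamma>\<^sup>2 / t) *\<^sub>R grad f x"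

text \<open>\<open>x\<close> solves the second order equation on \<open>T\<close>; \<open>v\<close> and \<open>a\<close> are its first and second derivatives.\<close>

definition hdd_solution ::
  "(real ^ 'n \<Rightarrow> real) \<Rightarrow> real \<Rightarrow> real \<Rightarrow> real \<Rightarrow> real set \<Rightarrow> (real \<Rightarrow> real ^ 'n) \<Rightarrow> bool" where
  "hdd_solution f \<alpha> \<beta> \<gamma> T x \<longleftrightarrow>
     (\<exists>v a. \<forall>t\<in>T.
        (x has_vector_derivative v t) (at t within T) \<and>
        (v has_vector_derivative a t) (at t within T) \<and>
        a t + (\<alpha> / t) *\<^sub>R v t + \<beta> *\<^sub>R hess_vec f (x t) (v t) =
          - ((\<beta> / t) *\<^sub>R grad f (x t)) - grad f (extrapolation (hess_vec f) f \<alpha> \<beta> \<gamma> t (x t) (v t)))"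


subsection \<open>The two subproblems, as vector fields on the phase space of pairs (x, v)\<close>

definition P1_field ::
  "(real ^ 'n \<Rightarrow> real ^ 'n \<Rightarrow> real ^ 'n) \<Rightarrow> (real ^ 'n \<Rightarrow> real) \<Rightarrow> real \<Rightarrow> real \<Rightarrow> real \<Rightarrow>
   real \<Rightarrow> (real ^ 'n) \<times> (real ^ 'n) \<Rightarrow> (real ^ 'n) \<times> (real ^ 'n)" where
  "P1_field H f \<alpha> \<beta> \<gamma> t = (\<lambda>(x, v).
     (0, - ((\<alpha> / t) *\<^sub>R v) - \<beta> *\<^sub>R H x v - (\<beta> / t) *\<^sub>R grad f x
           - grad f (extrapolation H f \<alpha> \<beta> \<gamma> t x v) + grad f x))"

definition P2_field ::
  "(real ^ 'n \<Rightarrow> real) \<Rightarrow> real \<Rightarrow> (real ^ 'n) \<times> (real ^ 'n) \<Rightarrow> (real ^ 'n) \<times> (real ^ 'n)" where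
  "P2_field f t = (\<lambda>(x, v). (v, - grad f x))"

definition integral_curve ::
  "(real \<Rightarrow> 'a::real_normed_vector \<Rightarrow> 'a) \<Rightarrow> real set \<Rightarrow> (real \<Rightarrow> 'a) \<Rightarrow> bool" where
  "integral_curve F T z \<longleftrightarrow> (\<forall>t\<in>T. (z has_vector_derivative F t (z t)) (at t within T))"


subsection \<open>One-step methods, as relations between the old and the new state\<close>

definition forward_euler_step ::
  "(real \<Rightarrow> 'a::real_vector \<Rightarrow> 'a) \<Rightarrow> real \<Rightarrow> real \<Rightarrow> 'a \<Rightarrow> 'a \<Rightarrow> bool" where
  "forward_euler_step F h t z z' \<longleftrightarrow> z' = z + h *\<^sub>R F t z"

text \<open>The variant of the symplectic Euler method that is implicit in the second component.
  For a field whose second component depends on the first variable only, it is explicit.\<close>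

definition symplectic_euler_step ::
  "(real \<Rightarrow> 'a::real_vector \<times> 'a \<Rightarrow> 'a \<times> 'a) \<Rightarrow> real \<Rightarrow> real \<Rightarrow> 'a \<times> 'a \<Rightarrow> 'a \<times> 'a \<Rightarrow> bool" where
  "symplectic_euler_step F h t z z' \<longleftrightarrow>
     snd z' = snd z + h *\<^sub>R snd (F t (fst z, snd z')) \<and>
     fst z' = fst z + h *\<^sub>R fst (F t (fst z, snd z'))"

definition lie_trotter_step ::
  "('a \<Rightarrow> 'a \<Rightarrow> bool) \<Rightarrow> ('a \<Rightarrow> 'a \<Rightarrow> bool) \<Rightarrow> 'a \<Rightarrow> 'a \<Rightarrow> bool" where
  "lie_trotter_step \<Phi>1 \<Phi>2 z z' \<longleftrightarrow> (\<exists>z_half. \<Phi>1 z z_half \<and> \<Phi>2 z_half z')"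


subsection \<open>The splitting scheme\<close>

text \<open>The initial data \<open>x 0\<close> and \<open>x 1\<close> are arbitrary. The value \<open>v 0\<close> is never used.\<close>

definition splitting_scheme ::
  "(real ^ 'n \<Rightarrow> real) \<Rightarrow> real \<Rightarrow> real \<Rightarrow> real \<Rightarrow> real \<Rightarrow>
   (nat \<Rightarrow> real ^ 'n) \<Rightarrow> (nat \<Rightarrow> real ^ 'n) \<Rightarrow> bool" where
  "splitting_scheme f \<alpha> \<beta> \<gamma> h x v \<longleftrightarrow>
     v 1 = (1 / h) *\<^sub>R (x 1 - x 0) \<and>
     (\<forall>n\<ge>1.
        let t = real n * h;
            H = (\<lambda>_ _. (1 / h) *\<^sub>R (grad f (x n) - grad f (x (n - 1))))
        in lie_trotter_step
             (forward_euler_step (P1_field H f \<alpha> \<beta> \<gamma>) h t)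
             (symplectic_euler_step (P2_field f) h t)
             (x n, v n) (x (n + 1), v (n + 1)))"

end

theory Submission
  imports Defs
begin

text \<open>The term \<open>grad f x\<close> added in the first field is cancelled by
  \<open>- grad f x\<close> in the second, so the sum of the two fields is the second order equation
  written on phase space (\<open>hdd_solution_iff_integral_curve\<close>). The same cancellation
  survives discretization: the Euler step does not move the position, so the symplectic step
  evaluates the gradient at \<open>x n\<close> again, and only the gradient at the extrapolated
  point remains (\<open>splitting_scheme_step\<close>). Since \<open>h *\<^sub>R v n\<close> is the
  last displacement (\<open>splitting_scheme_velocity\<close>), taking \<gamma> = h turns the
  extrapolated point into \<open>y\<close>. Apart from that last gradient, the new position is the
  same expression, so it equals \<open>y - h\<^sup>2 *\<^sub>R grad f y\<close>.\<close>

lemma has_vector_derivative_Pair_iff: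
  "((\<lambda>t. (x t, v t)) has_vector_derivative (a, b)) (at s within T) \<longleftrightarrow>
     (x has_vector_derivative a) (at s within T) \<and> (v has_vector_derivative b) (at s within T)"
proof
  assume D: "((\<lambda>t. (x t, v t)) has_vector_derivative (a, b)) (at s within T)"
  show "(x has_vector_derivative a) (at s within T) \<and> (v has_vector_derivative b) (at s within T)"
    using bounded_linear.has_vector_derivative[OF bounded_linear_fst D]
      bounded_linear.has_vector_derivative[OF bounded_linear_snd D] by simp
next
  assume "(x has_vector_derivative a) (at s within T) \<and> (v has_vector_derivative b) (at s within T)"
  then show "((\<lambda>t. (x t, v t)) has_vector_derivative (a, b)) (at s within T)"
    using has_derivative_Pair unfolding has_vector_derivative_def by fastforce
qed

text \<open>The first component of the summed field makes \<open>v\<close> the derivative of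
  \<open>x\<close>; the second is the equation solved for the acceleration. The argument is
  pointwise in time, hence the arbitrary set \<open>T\<close>.\<close>

lemma hdd_solution_iff_integral_curve:
  "hdd_solution f \<alpha> \<beta> \<gamma> T x \<longleftrightarrow>
     (\<exists>v. integral_curve (\<lambda>t z. P1_field (hess_vec f) f \<alpha> \<beta> \<gamma> t z + P2_field f t z)
            T (\<lambda>t. (x t, v t)))"
proof -
  let ?b = "\<lambda>t x v. - ((\<alpha> / t) *\<^sub>R v) - \<beta> *\<^sub>R hess_vec f x v - (\<beta> / t) *\<^sub>R grad f x
              - grad f (extrapolation (hess_vec f) f \<alpha> \<beta> \<gamma> t x v)"
  have field: "P1_field (hess_vec f) f \<alpha> \<beta> \<gamma> t (x, v) + P2_field f t (x, v) = (v, ?b t x v)"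
    for t x v
    by (simp add: P1_field_def P2_field_def)
  have solve: "a + (\<alpha> / t) *\<^sub>R v + \<beta> *\<^sub>R hess_vec f x v =
      - ((\<beta> / t) *\<^sub>R grad f x) - grad f (extrapolation (hess_vec f) f \<alpha> \<beta> \<gamma> t x v)
      \<longleftrightarrow> a = ?b t x v" for a t x v
    by (simp add: algebra_simps eq_neg_iff_add_eq_0)
  show ?thesis
    \<comment> \<open>Both sides now quantify over the same \<open>v\<close>; what remains is to
      eliminate \<open>a\<close>, which the equation determines from \<open>x\<close> and
      \<open>v\<close>.\<close>
    unfolding hdd_solution_def integral_curve_def field solve has_vector_derivative_Pair_iff
  proof (rule ex_cong1, rule iffI)
    fix v
    assume "\<exists>a. \<forall>t\<in>T. (x has_vector_derivative v t) (at t within T) \<and>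
      (v has_vector_derivative a t) (at t within T) \<and> a t = ?b t (x t) (v t)"
    then obtain a where "\<forall>t\<in>T. (x has_vector_derivative v t) (at t within T) \<and>
      (v has_vector_derivative a t) (at t within T) \<and> a t = ?b t (x t) (v t)" ..
    then show "\<forall>t\<in>T. (x has_vector_derivative v t) (at t within T) \<and>
      (v has_vector_derivative ?b t (x t) (v t)) (at t within T)" by metis
  next
    fix v
    assume "\<forall>t\<in>T. (x has_vector_derivative v t) (at t within T) \<and>
      (v has_vector_derivative ?b t (x t) (v t)) (at t within T)"
    then show "\<exists>a. \<forall>t\<in>T. (x has_vector_derivative v t) (at t within T) \<and>
      (v has_vector_derivative a t) (at t within T) \<and> a t = ?b t (x t) (v t)"
      by (intro exI[of _ "\<lambda>t. ?b t (x t) (v t)"]) simp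
  qed
qed

text \<open>Eliminating the intermediate state gives an explicit recursion: its position is still
  \<open>x n\<close>, so the two contributions \<open>h *\<^sub>R grad f (x n)\<close> of opposite
  sign cancel.\<close>

lemma splitting_scheme_step:
  assumes S: "splitting_scheme f \<alpha> \<beta> \<gamma> h x v" and n: "n \<ge> 1"
  defines "H \<equiv> \<lambda>_ _. (1 / h) *\<^sub>R (grad f (x n) - grad f (x (n - 1)))"
  defines "t \<equiv> real n * h"
  shows "x (n + 1) = x n + h *\<^sub>R v (n + 1)"
    and "v (n + 1) = v n - (h * \<alpha> / t) *\<^sub>R v n - (h * \<beta>) *\<^sub>R H (x n) (v n)
           - (h * \<beta> / t) *\<^sub>R grad f (x n)
           - h *\<^sub>R grad f (extrapolation H f \<alpha> \<beta> \<gamma> t (x n) (v n))"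
proof -
  have step: "lie_trotter_step (forward_euler_step (P1_field H f \<alpha> \<beta> \<gamma>) h t)
      (symplectic_euler_step (P2_field f) h t) (x n, v n) (x (n + 1), v (n + 1))"
    using S n unfolding splitting_scheme_def H_def t_def Let_def by blast
  then show "x (n + 1) = x n + h *\<^sub>R v (n + 1)"
    by (auto simp: lie_trotter_step_def forward_euler_step_def symplectic_euler_step_def
        P1_field_def P2_field_def)
  show "v (n + 1) = v n - (h * \<alpha> / t) *\<^sub>R v n - (h * \<beta>) *\<^sub>R H (x n) (v n)
           - (h * \<beta> / t) *\<^sub>R grad f (x n)
           - h *\<^sub>R grad f (extrapolation H f \<alpha> \<beta> \<gamma> t (x n) (v n))"
    using step
    by (auto simp: lie_trotter_step_def forward_euler_step_def symplectic_euler_step_def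
        P1_field_def P2_field_def scaleR_diff_right scaleR_add_right)
qed

text \<open>For n = 1 this is the choice of initial velocity; for n > 1 it is the position update of
  the preceding step, which exists because n - 1 is at least 1.\<close>

lemma splitting_scheme_velocity:
  assumes S: "splitting_scheme f \<alpha> \<beta> \<gamma> h x v" and "h \<noteq> 0" "n \<ge> 1"
  shows "h *\<^sub>R v n = x n - x (n - 1)"
proof (cases "n = 1")
  case True
  then show ?thesis using S \<open>h \<noteq> 0\<close> by (simp add: splitting_scheme_def)
next
  case False
  then have "n - 1 \<ge> 1" using \<open>n \<ge> 1\<close> by simp
  from splitting_scheme_step(1)[OF S this] show ?thesis using \<open>n \<ge> 1\<close> by simp
qed

text \<open>The extrapolation parameter is set equal to the stepsize, which makes the coefficients
  of the extrapolated point agree with those of the position update.\<close>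

lemma splitting_scheme_IGAHD:
  assumes S: "splitting_scheme f \<alpha> \<beta> h h x v" and h: "h \<noteq> 0" and n: "n \<ge> 1"
  defines "y \<equiv> x n + (1 - \<alpha> / real n) *\<^sub>R (x n - x (n - 1))
                 - (\<beta> * h) *\<^sub>R (grad f (x n) - grad f (x (n - 1)))
                 - (\<beta> * h / real n) *\<^sub>R grad f (x n)"
  shows "x (n + 1) = y - h\<^sup>2 *\<^sub>R grad f y"
proof -
  define g where "g = grad f (x n) - grad f (x (n - 1))"
  define H :: "real ^ 'a \<Rightarrow> real ^ 'a \<Rightarrow> real ^ 'a" where "H = (\<lambda>_ _. (1 / h) *\<^sub>R g)"
  define t where "t = real n * h"
  note vel = splitting_scheme_velocity[OF S h n]
  \<comment> \<open>At time n h one factor h cancels against \<open>t\<close>, leaving coefficients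
    in 1/n.\<close>
  have coeffs: "h * (\<alpha> / t) = \<alpha> / real n" "\<beta> * h\<^sup>2 / t = \<beta> * h / real n"
    using h n by (simp_all add: t_def power2_eq_square)
  have y: "y = x n + (1 - \<alpha> / real n) *\<^sub>R (h *\<^sub>R v n) - (\<beta> * h) *\<^sub>R g
      - (\<beta> * h / real n) *\<^sub>R grad f (x n)"
    by (simp add: y_def g_def vel)
  \<comment> \<open>The factor 1/h in the difference quotient \<open>H\<close> reduces the Hessian
    coefficient \<open>\<beta> * h\<^sup>2\<close> to \<open>\<beta> * h\<close>.\<close>
  have ext: "extrapolation H f \<alpha> \<beta> h t (x n) (v n) = y"
    using h coeffs by (simp add: extrapolation_def y H_def power2_eq_square ac_simps)
  have "x (n + 1) = x n + h *\<^sub>R (v n - (\<alpha> / real n) *\<^sub>R v n - \<beta> *\<^sub>R g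
      - (\<beta> / real n) *\<^sub>R grad f (x n) - h *\<^sub>R grad f y)"
    using splitting_scheme_step[OF S n, folded g_def, folded H_def t_def] ext h
    by (simp add: H_def t_def)
  \<comment> \<open>Distributing the outer h over every term but the last, and adding
    \<open>x n\<close>, reproduces \<open>y\<close> in its velocity form; the last term supplies the
    gradient step.\<close>
  also have "\<dots> = y - h\<^sup>2 *\<^sub>R grad f y"
    by (simp add: y algebra_simps power2_eq_square)
  finally show ?thesis .
qed

theorem theorem4:
  fixes f :: "real ^ 'n \<Rightarrow> real" and \<alpha> \<beta> \<gamma> h :: real
  assumes "C2 f" and "h > 0" and "\<gamma> = h"
  shows "(\<forall>t0>0. \<forall>x. hdd_solution f \<alpha> \<beta> \<gamma> {t0..} x \<longleftrightarrow>
            (\<exists>v. integral_curve (\<lambda>t z. P1_field (hess_vec f) f \<alpha> \<beta> \<gamma> t z + P2_field f t z)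
                   {t0..} (\<lambda>t. (x t, v t)))) \<and>
         (\<forall>x v. splitting_scheme f \<alpha> \<beta> \<gamma> h x v \<longrightarrow>
            (\<forall>n\<ge>1.
               let \<alpha>n = 1 - \<alpha> / real n;
                   y = x n + \<alpha>n *\<^sub>R (x n - x (n - 1))
                         - (\<beta> * h) *\<^sub>R (grad f (x n) - grad f (x (n - 1)))
                         - (\<beta> * h / real n) *\<^sub>R grad f (x n)
               in x (n + 1) = y - h\<^sup>2 *\<^sub>R grad f y))"
proof (intro conjI allI impI)
  fix t0 :: real and x
  show "hdd_solution f \<alpha> \<beta> \<gamma> {t0..} x \<longleftrightarrow>
      (\<exists>v. integral_curve (\<lambda>t z. P1_field (hess_vec f) f \<alpha> \<beta> \<gamma> t z + P2_field f t z)
             {t0..} (\<lambda>t. (x t, v t)))"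
    by (rule hdd_solution_iff_integral_curve)
next
  fix x v :: "nat \<Rightarrow> real ^ 'n" and n :: nat
  assume "splitting_scheme f \<alpha> \<beta> \<gamma> h x v" "n \<ge> 1"
  then show "let \<alpha>n = 1 - \<alpha> / real n;
                 y = x n + \<alpha>n *\<^sub>R (x n - x (n - 1))
                       - (\<beta> * h) *\<^sub>R (grad f (x n) - grad f (x (n - 1)))
                       - (\<beta> * h / real n) *\<^sub>R grad f (x n)
             in x (n + 1) = y - h\<^sup>2 *\<^sub>R grad f y"
    unfolding Let_def using splitting_scheme_IGAHD[of f \<alpha> \<beta> h x v n] assms by simp
qed

end
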